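(* Let $\mathbf m=(m_1,\ldots,m_p)\in\mathbb N^p$, $n\in\mathbb N$ and $|x|<1$. Then \[ 2n\int_0^x t^{2n-1}dt\,\frac{dt}{1-t^2}\Big(\frac{dt}{t}\Big)^{m_1-1}\frac{t\,dt}{1-t^2}\Big(\frac{dt}{t}\Big)^{m_2-1}\cdots\frac{t\,dt}{1-t^2}\Big(\frac{dt}{t}\Big)^{m_p-1} =(2n-1)\int_0^x t^{2n-2}dt\,\frac{t\,dt}{1-t^2}\Big(\frac{dt}{t}\Big)^{m_1-1}\frac{t\,dt}{1-t^2}\Big(\frac{dt}{t}\Big)^{m_2-1}\cdots\frac{t\,dt}{1-t^2}\Big(\frac{dt}{t}\Big)^{m_p-1} \] \[ =\sum_{j=1}^p(-1)^{j-1}t^\star_n(m_1,\ldots,m_{j-1})\,\mathrm{ti}_{m_p,\ldots,m_j}(x)+(-1)^p t^\star_n(\mathbf m;x). \]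
   Context: Iterated integrals: $\int_a^b f_q(t)dt\cdots f_1(t)dt:=\int_{a<t_q<\cdots<t_1<b}f_q(t_q)\cdots f_1(t_1)\,dt_1\cdots dt_q$, along the straight segment. For a composition $\mathbf k=(k_1,\ldots,k_r)$: $t^\star_n(\mathbf k)=\sum_{n\ge n_1\ge\cdots\ge n_r\ge1}\prod_i(2n_i-1)^{-k_i}$ (with $t^\star_n(\emptyset)=1$), $t^\star_n(\mathbf k;x)=\sum_{n\ge n_1\ge\cdots\ge n_r\ge1}x^{2n_r-1}\prod_i(2n_i-1)^{-k_i}$, and the multiple $t$-polylogarithm $\mathrm{ti}_{\mathbf k}(x)=\sum_{n_1>\cdots>n_r>0}x^{2n_1-1}\prod_i(2n_i-1)^{-k_i}$. *)

theory Defs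
  imports "HOL-Analysis.Analysis"
begin

definition osimplex :: "nat \<Rightarrow> (nat \<Rightarrow> real) set" where
  "osimplex q = {s. (\<forall>i<q. 0 < s i \<and> s i < 1) \<and> (\<forall>i j. i < j \<and> j < q \<longrightarrow> s i < s j)}"

text \<open>Iterated integral along the straight segment from a to b.
  The list fs = [g_0, ..., g_(q-1)] is the integrand written left to right,
  i.e. iint a b fs = int_a^b g_0(t)dt ... g_(q-1)(t)dt
  = int_(a < t_0 < ... < t_(q-1) < b) g_0(t_0) ... g_(q-1)(t_(q-1)),
  with the ordering taken along the segment t = a + s (b - a), 0 < s < 1.\<close>
definition iint :: "complex \<Rightarrow> complex \<Rightarrow> (complex \<Rightarrow> complex) list \<Rightarrow> complex" where
  "iint a b fs = (b - a) ^ length fs *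
     (LINT s : osimplex (length fs) | PiM {..<length fs} (\<lambda>_. lborel).
        (\<Prod>i<length fs. (fs ! i) (a + of_real (s i) * (b - a))))"

definition blk :: "nat \<Rightarrow> (complex \<Rightarrow> complex) \<Rightarrow> (complex \<Rightarrow> complex) list" where
  "blk k f = f # replicate (k - 1) (\<lambda>t. 1 / t)"

definition idx_le :: "nat \<Rightarrow> nat \<Rightarrow> nat list set" where
  "idx_le n r = {ns. length ns = r \<and> (\<forall>i<r. 1 \<le> ns ! i \<and> ns ! i \<le> n) \<and> sorted_wrt (\<ge>) ns}"

definition tstar :: "nat \<Rightarrow> nat list \<Rightarrow> complex" where
  "tstar n ks = (\<Sum>ns\<in>idx_le n (length ks).
      \<Prod>i<length ks. 1 / (of_nat (2 * ns ! i - 1)) ^ (ks ! i))"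

text \<open>t*_n(k; x); the factor x^(2 n_r - 1) uses the last index n_r (only used for r >= 1).\<close>
definition tstarx :: "nat \<Rightarrow> nat list \<Rightarrow> complex \<Rightarrow> complex" where
  "tstarx n ks x = (\<Sum>ns\<in>idx_le n (length ks).
      x ^ (2 * last ns - 1) * (\<Prod>i<length ks. 1 / (of_nat (2 * ns ! i - 1)) ^ (ks ! i)))"

definition idx_gt :: "nat \<Rightarrow> nat list set" where
  "idx_gt r = {ns. length ns = r \<and> (\<forall>i<r. 0 < ns ! i) \<and> sorted_wrt (>) ns}"

definition ti :: "nat list \<Rightarrow> complex \<Rightarrow> complex" where
  "ti ks x = (\<Sum>\<^sub>\<infinity>ns\<in>idx_gt (length ks).
      x ^ (2 * hd ns - 1) * (\<Prod>i<length ks. 1 / (of_nat (2 * ns ! i - 1)) ^ (ks ! i)))"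

end

theory Submission
  imports Defs
begin

text \<open>
  The first form contributes \<open>t\<^bsup>2n\<^esup>\<close> to the first integral and \<open>t\<^bsup>2n-1\<^esup>\<close> to the second; since
  \<open>t\<^bsup>2n\<^esup> \<sqdot> 1/(1-t\<^sup>2) = t\<^bsup>2n-1\<^esup> \<sqdot> t/(1-t\<^sup>2)\<close>, they agree from the second form on. Every further partial
  iterated integral is an odd power series \<open>\<Sum>\<^sub>l c\<^sub>l z\<^bsup>2l-1\<^esup>\<close> on the unit disc: a form \<open>dt/t\<close> divides
  \<open>c\<^sub>l\<close> by \<open>2l-1\<close>, and a form \<open>t dt/(1-t\<^sup>2)\<close> replaces \<open>c\<^sub>l\<close> by \<open>(c\<^sub>1 + \<dots> + c\<^bsub>l-1\<^esub>)/(2l-1)\<close>.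
  Hence both integrals equal
  \<open>S\<^sub>n(m\<^sub>1,\<dots>,m\<^sub>p) = \<Sum> x\<^bsup>2l\<^sub>p-1\<^esup> / \<Prod>\<^sub>i (2l\<^sub>i-1)\<^bsup>m\<^sub>i\<^esup>\<close>, summed over \<open>l\<^sub>p > \<dots> > l\<^sub>1 > n\<close>.
  Writing the sum over \<open>l\<^sub>1 > n\<close> as the full sum minus the sum over \<open>l\<^sub>1 \<le> n\<close> gives
  \<open>S\<^sub>n(m\<^sub>1,\<dots>,m\<^sub>p) = ti\<^bsub>m\<^sub>p,\<dots>,m\<^sub>1\<^esub>(x) - \<Sum>\<^bsub>1\<le>l\<le>n\<^esub> S\<^sub>l(m\<^sub>2,\<dots>,m\<^sub>p) / (2l-1)\<^bsup>m\<^sub>1\<^esup>\<close>,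
  and the formula follows by induction on \<open>p\<close>.
\<close>

section \<open>Integrals over ordered simplices\<close>

lemma (in product_sigma_finite) distr_insert:
  assumes "finite I" "i \<notin> I"
  shows "distr (M i \<Otimes>\<^sub>M PiM I M) (PiM (insert i I) M) (\<lambda>(y, x). x(i := y)) = PiM (insert i I) M"
    (is "distr ?P ?Q ?upd = _")
proof (rule measure_eqI)
  fix A assume "A \<in> sets (distr ?P ?Q ?upd)"
  then have A [measurable]: "A \<in> sets ?Q" by simp
  interpret I: finite_product_sigma_finite M I
    by standard (fact assms)
  have upd [measurable]: "?upd \<in> measurable ?P ?Q" by measurable
  have "emeasure (distr ?P ?Q ?upd) A = (\<integral>\<^sup>+p. indicator A (?upd p) \<partial>?P)"
    by (subst nn_integral_indicator[symmetric], simp, subst nn_integral_distr) simp_all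
  also have "\<dots> = (\<integral>\<^sup>+y. \<integral>\<^sup>+x. indicator A (x(i := y)) \<partial>PiM I M \<partial>M i)"
    by (subst I.nn_integral_fst[symmetric]) auto
  also have "\<dots> = emeasure ?Q A"
    using assms by (simp flip: product_nn_integral_insert_rev)
  finally show "emeasure (distr ?P ?Q ?upd) A = emeasure ?Q A" .
qed simp

lemma (in product_sigma_finite)
  fixes f :: "_ \<Rightarrow> _::{banach, second_countable_topology}"
  assumes "finite I" "i \<notin> I" and f: "integrable (PiM (insert i I) M) f"
  shows integrable_product_insert_rev:
      "integrable (M i) (\<lambda>y. \<integral>x. f (x(i := y)) \<partial>PiM I M)"
    and product_integral_insert_rev:
      "integral\<^sup>L (PiM (insert i I) M) f = (\<integral>y. \<integral>x. f (x(i := y)) \<partial>PiM I M \<partial>M i)"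
proof -
  interpret I: finite_product_sigma_finite M I
    by standard (fact assms)
  interpret pair_sigma_finite "M i" "PiM I M" ..
  let ?upd = "\<lambda>(y, x). x(i := y)"
  have upd: "?upd \<in> measurable (M i \<Otimes>\<^sub>M PiM I M) (PiM (insert i I) M)" by measurable
  have "integrable (M i \<Otimes>\<^sub>M PiM I M) (\<lambda>p. f (?upd p))"
    using f by (intro integrable_distr[OF upd]) (simp add: distr_insert assms)
  from integrable_fst'[OF this] integral_fst'[OF this]
  show "integrable (M i) (\<lambda>y. \<integral>x. f (x(i := y)) \<partial>PiM I M)"
    and "integral\<^sup>L (PiM (insert i I) M) f = (\<integral>y. \<integral>x. f (x(i := y)) \<partial>PiM I M \<partial>M i)"
    using integral_distr[OF upd, of f] f by (simp_all add: distr_insert assms)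
qed

interpretation lborels: product_sigma_finite "\<lambda>_::nat. lborel :: real measure"
  by standard

definition scaled_simplex :: "nat \<Rightarrow> real \<Rightarrow> (nat \<Rightarrow> real) set" where
  "scaled_simplex q u = {s. (\<forall>i<q. 0 < s i \<and> s i < u) \<and> (\<forall>i j. i < j \<and> j < q \<longrightarrow> s i < s j)}"

definition simplex_integrand ::
    "(real \<Rightarrow> 'a::real_normed_field) list \<Rightarrow> real \<Rightarrow> (nat \<Rightarrow> real) \<Rightarrow> 'a" where
  "simplex_integrand gs u s =
     indicator (scaled_simplex (length gs) u) s *\<^sub>R (\<Prod>i<length gs. (gs ! i) (s i))"

definition simplex_integral ::
    "(real \<Rightarrow> 'a::{real_normed_field, banach, second_countable_topology}) list \<Rightarrow> real \<Rightarrow> 'a" where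
  "simplex_integral gs u = integral\<^sup>L (PiM {..<length gs} (\<lambda>_. lborel)) (simplex_integrand gs u)"

definition simplex_nn_integral :: "(real \<Rightarrow> 'a::real_normed_field) list \<Rightarrow> real \<Rightarrow> ennreal" where
  "simplex_nn_integral gs u =
     (\<integral>\<^sup>+s. ennreal (norm (simplex_integrand gs u s)) \<partial>PiM {..<length gs} (\<lambda>_. lborel))"

lemma simplex_integrand_snoc:
  "simplex_integrand (gs @ [g]) u (s(length gs := y)) =
     indicator {0<..<u} y *\<^sub>R (g y * simplex_integrand gs y s)"
proof -
  have "s(length gs := y) \<in> scaled_simplex (Suc (length gs)) u \<longleftrightarrow>
      y \<in> {0<..<u} \<and> s \<in> scaled_simplex (length gs) y"
    unfolding scaled_simplex_def by (auto simp: less_Suc_eq)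
  then show ?thesis
    by (auto simp: simplex_integrand_def indicator_def nth_append intro!: prod.cong)
qed

lemma simplex_nn_integral_Nil: "simplex_nn_integral [] u = 1"
  by (simp add: simplex_nn_integral_def simplex_integrand_def scaled_simplex_def PiM_empty
      nn_integral_count_space_finite)

lemma simplex_integral_Nil: "simplex_integral [] u = 1"
  by (simp add: simplex_integral_def simplex_integrand_def scaled_simplex_def PiM_empty
      lebesgue_integral_count_space_finite)

lemma pred_in_scaled_simplex:
  "Measurable.pred (PiM {..<q} (\<lambda>_. lborel)) (\<lambda>s. s \<in> scaled_simplex q u)"
proof -
  have "Measurable.pred (PiM {..<q} (\<lambda>_. lborel)) (\<lambda>s. (\<forall>i\<in>{..<q}. 0 < s i \<and> s i < u) \<and>
      (\<forall>j\<in>{..<q}. \<forall>i\<in>{..<j}. s i < s j))"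
    by measurable
  also have "(\<lambda>s. (\<forall>i\<in>{..<q}. 0 < s i \<and> s i < u) \<and> (\<forall>j\<in>{..<q}. \<forall>i\<in>{..<j}. s i < s j)) =
      (\<lambda>s. s \<in> scaled_simplex q u)"
    by (auto simp: scaled_simplex_def fun_eq_iff)
  finally show ?thesis .
qed

lemma measurable_simplex_integrand:
  fixes gs :: "(real \<Rightarrow> 'a::{real_normed_field, second_countable_topology}) list"
  assumes "\<And>g. g \<in> set gs \<Longrightarrow> g \<in> borel_measurable borel"
  shows "simplex_integrand gs u \<in> borel_measurable (PiM {..<length gs} (\<lambda>_. lborel))"
proof -
  note [measurable] = pred_in_scaled_simplex
  have [measurable]: "gs ! i \<in> borel_measurable borel" if "i < length gs" for i
    using assms that by simp
  show ?thesis
    unfolding simplex_integrand_def[abs_def] by measurable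
qed

lemma simplex_nn_integral_snoc:
  fixes gs :: "(real \<Rightarrow> 'a::{real_normed_field, second_countable_topology}) list"
  assumes "\<And>h. h \<in> set (gs @ [g]) \<Longrightarrow> h \<in> borel_measurable borel"
  shows "simplex_nn_integral (gs @ [g]) u =
    (\<integral>\<^sup>+y\<in>{0<..<u}. ennreal (norm (g y)) * simplex_nn_integral gs y \<partial>lborel)"
proof -
  have ins: "{..<length (gs @ [g])} = insert (length gs) {..<length gs}" by auto
  note [measurable] = measurable_simplex_integrand[of "gs @ [g]" u, OF assms, unfolded ins]
  have [measurable]: "simplex_integrand gs y \<in> borel_measurable (PiM {..<length gs} (\<lambda>_. lborel))" for y
    using assms by (intro measurable_simplex_integrand) auto
  show ?thesis
    unfolding simplex_nn_integral_def ins
    by (subst lborels.product_nn_integral_insert_rev)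
       (auto simp: simplex_integrand_snoc indicator_def norm_mult ennreal_mult' nn_integral_cmult
          intro!: nn_integral_cong)
qed

text \<open>The first function is bounded and the others are \<open>O(1/s)\<close>, so the iterated integral up to
  \<open>u\<close> is \<open>O(u)\<close>, which absorbs the singularity of the next function.\<close>
inductive simplex_admissible :: "(real \<Rightarrow> 'a::real_normed_field) list \<Rightarrow> bool" where
  single: "simplex_admissible [g]"
    if "g \<in> borel_measurable borel" "\<And>s. s \<in> {0<..<1} \<Longrightarrow> norm (g s) \<le> K"
| snoc: "simplex_admissible (gs @ [g])"
    if "simplex_admissible gs" "g \<in> borel_measurable borel"
      "\<And>s. s \<in> {0<..<1} \<Longrightarrow> norm (g s) \<le> K / s"

lemma simplex_admissible_measurable:
  "simplex_admissible gs \<Longrightarrow> g \<in> set gs \<Longrightarrow> g \<in> borel_measurable borel"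
  by (induction rule: simplex_admissible.induct) auto

lemma simplex_nn_integral_snoc_le:
  fixes gs :: "(real \<Rightarrow> 'a::{real_normed_field, second_countable_topology}) list"
  assumes meas: "\<And>h. h \<in> set (gs @ [g]) \<Longrightarrow> h \<in> borel_measurable borel"
    and bound: "\<And>y. y \<in> {0<..<1} \<Longrightarrow> ennreal (norm (g y)) * simplex_nn_integral gs y \<le> ennreal C"
    and u: "u \<in> {0<..1}"
  shows "simplex_nn_integral (gs @ [g]) u \<le> ennreal (C * u)"
proof -
  have "simplex_nn_integral (gs @ [g]) u =
      (\<integral>\<^sup>+y\<in>{0<..<u}. ennreal (norm (g y)) * simplex_nn_integral gs y \<partial>lborel)"
    using meas by (rule simplex_nn_integral_snoc)
  also have "\<dots> \<le> (\<integral>\<^sup>+y\<in>{0<..<u}. ennreal C \<partial>lborel)"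
    using bound u by (intro nn_integral_mono) (auto simp: indicator_def)
  also have "\<dots> = ennreal (C * u)"
    using u by (subst nn_integral_cmult_indicator) (auto simp: ennreal_mult'')
  finally show ?thesis .
qed

lemma simplex_nn_integral_bigo:
  fixes gs :: "(real \<Rightarrow> 'a::{real_normed_field, second_countable_topology}) list"
  assumes "simplex_admissible gs"
  shows "\<exists>C. \<forall>u\<in>{0<..1}. simplex_nn_integral gs u \<le> ennreal (C * u)"
  using assms
proof induction
  case (single g K)
  then have "simplex_nn_integral ([] @ [g]) u \<le> ennreal (K * u)" if "u \<in> {0<..1}" for u
    using that by (intro simplex_nn_integral_snoc_le) (auto simp: simplex_nn_integral_Nil ennreal_leI)
  then show ?case unfolding append_Nil by blast
next
  case (snoc gs g K)
  then obtain C where C: "\<And>u. u \<in> {0<..1} \<Longrightarrow> simplex_nn_integral gs u \<le> ennreal (C * u)"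
    by blast
  have "simplex_nn_integral (gs @ [g]) u \<le> ennreal (K * C * u)" if "u \<in> {0<..1}" for u
  proof (rule simplex_nn_integral_snoc_le[OF _ _ that])
    show "h \<in> borel_measurable borel" if "h \<in> set (gs @ [g])" for h
      using that snoc.hyps simplex_admissible_measurable by auto
    fix y :: real assume y: "y \<in> {0<..<1}"
    then have g: "norm (g y) \<le> K / y" by (rule snoc.hyps)
    then have "ennreal (norm (g y)) * simplex_nn_integral gs y \<le> ennreal (K / y) * ennreal (C * y)"
      using y by (intro mult_mono ennreal_leI C) auto
    also have "\<dots> = ennreal (K * C)"
      using y order_trans[OF norm_ge_zero g] by (subst ennreal_mult'[symmetric]) auto
    finally show "ennreal (norm (g y)) * simplex_nn_integral gs y \<le> ennreal (K * C)" .
  qed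
  then show ?case by blast
qed

lemma integrable_simplex_integrand:
  fixes gs :: "(real \<Rightarrow> 'a::{real_normed_field, banach, second_countable_topology}) list"
  assumes adm: "simplex_admissible gs" and u: "u \<in> {0<..1}"
  shows "integrable (PiM {..<length gs} (\<lambda>_. lborel)) (simplex_integrand gs u)"
proof (rule integrableI_bounded)
  show "simplex_integrand gs u \<in> borel_measurable (PiM {..<length gs} (\<lambda>_. lborel))"
    using simplex_admissible_measurable[OF adm] by (rule measurable_simplex_integrand)
  obtain C where "simplex_nn_integral gs u \<le> ennreal (C * u)"
    using simplex_nn_integral_bigo[OF adm] u by blast
  then show "(\<integral>\<^sup>+s. norm (simplex_integrand gs u s) \<partial>PiM {..<length gs} (\<lambda>_. lborel)) < \<infinity>"
    unfolding simplex_nn_integral_def by (rule le_less_trans) simp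
qed

lemma
  fixes gs :: "(real \<Rightarrow> 'a::{real_normed_field, banach, second_countable_topology}) list"
  assumes adm: "simplex_admissible (gs @ [g])" and u: "u \<in> {0<..1}"
  shows set_integrable_simplex_integral:
      "set_integrable lborel {0<..<u} (\<lambda>y. g y * simplex_integral gs y)"
    and simplex_integral_snoc:
      "simplex_integral (gs @ [g]) u = (LINT y:{0<..<u}|lborel. g y * simplex_integral gs y)"
proof -
  have ins: "{..<length (gs @ [g])} = insert (length gs) {..<length gs}" by auto
  have slice: "(\<integral>s. simplex_integrand (gs @ [g]) u (s(length gs := y)) \<partial>PiM {..<length gs} (\<lambda>_. lborel)) =
      indicator {0<..<u} y *\<^sub>R (g y * simplex_integral gs y)" for y
    by (simp add: simplex_integrand_snoc simplex_integral_def)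
  have int: "integrable (PiM (insert (length gs) {..<length gs}) (\<lambda>_. lborel))
      (simplex_integrand (gs @ [g]) u)"
    using integrable_simplex_integrand[OF adm u] unfolding ins .
  show "set_integrable lborel {0<..<u} (\<lambda>y. g y * simplex_integral gs y)"
    using lborels.integrable_product_insert_rev[OF _ _ int] by (simp add: slice set_integrable_def)
  show "simplex_integral (gs @ [g]) u = (LINT y:{0<..<u}|lborel. g y * simplex_integral gs y)"
    using lborels.product_integral_insert_rev[OF _ _ int]
    by (simp add: slice set_lebesgue_integral_def simplex_integral_def[of "gs @ [g]"] lessThan_Suc)
qed

lemma set_integral_Ioo_FTC:
  fixes f F :: "real \<Rightarrow> 'a::euclidean_space"
  assumes "a \<le> b" and int: "set_integrable lborel {a<..<b} f" and "continuous_on {a..b} F"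
    and "\<And>t. t \<in> {a<..<b} \<Longrightarrow> (F has_vector_derivative f t) (at t)"
  shows "(LINT t:{a<..<b}|lborel. f t) = F b - F a"
proof -
  have "(f has_integral F b - F a) {a..b}"
    using assms by (intro fundamental_theorem_of_calculus_interior) auto
  then show ?thesis
    unfolding set_borel_integral_eq_integral(2)[OF int]
    by (simp add: has_integral_Icc_iff_Ioo integral_unique)
qed

section \<open>Primitives along a segment\<close>

definition segment_primitive :: "complex \<Rightarrow> (complex \<Rightarrow> complex) \<Rightarrow> (complex \<Rightarrow> complex) \<Rightarrow> bool" where
  "segment_primitive x q Q \<longleftrightarrow> continuous_on (closed_segment 0 x) Q \<and> Q 0 = 0 \<and>
     (\<forall>z\<in>closed_segment 0 x - {0}. (Q has_field_derivative q z) (at z))"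

definition pullback :: "complex \<Rightarrow> (complex \<Rightarrow> complex) \<Rightarrow> real \<Rightarrow> complex" where
  "pullback x f s = f (of_real s * x) * x"

definition iterated_primitive ::
    "complex \<Rightarrow> (complex \<Rightarrow> complex) list \<Rightarrow> (complex \<Rightarrow> complex) \<Rightarrow> bool" where
  "iterated_primitive x fs P \<longleftrightarrow> simplex_admissible (map (pullback x) fs) \<and>
     (\<forall>u\<in>{0<..1}. simplex_integral (map (pullback x) fs) u = P (of_real u * x))"

lemma iint_eq_simplex_integral: "iint 0 x fs = simplex_integral (map (pullback x) fs) 1"
proof -
  have "osimplex q = scaled_simplex q 1" for q
    by (auto simp: osimplex_def scaled_simplex_def)
  then have "x ^ length fs * (indicator (osimplex (length fs)) s *\<^sub>R
      (\<Prod>i<length fs. (fs ! i) (0 + of_real (s i) * (x - 0)))) =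
    simplex_integrand (map (pullback x) fs) 1 s" for s
    by (simp add: simplex_integrand_def pullback_def prod.distrib)
  then show ?thesis
    by (simp add: iint_def simplex_integral_def set_lebesgue_integral_def
        flip: integral_mult_right_zero)
qed

lemma iterated_primitive_iint: "iterated_primitive x fs P \<Longrightarrow> iint 0 x fs = P x"
  by (simp add: iterated_primitive_def iint_eq_simplex_integral)

lemma iint_Cons_cmult: "iint a b ((\<lambda>t. c * f t) # fs) = c * iint a b (f # fs)"
  by (simp add: iint_def prod.lessThan_Suc_shift mult.assoc mult.left_commute[of _ c]
      del: prod.lessThan_Suc)

lemma of_real_mult_in_closed_segment:
  fixes x :: complex
  assumes "t \<in> {0..1}"
  shows "of_real t * x \<in> closed_segment 0 x"
  using assms by (auto simp: in_segment scaleR_conv_of_real)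

lemma set_integral_pullback_FTC:
  assumes Q: "segment_primitive x q Q" and u: "u \<in> {0<..1}"
    and int: "set_integrable lborel {0<..<u} (pullback x q)"
  shows "(LINT t:{0<..<u}|lborel. pullback x q t) = Q (of_real u * x)"
proof -
  have seg: "of_real t * x \<in> closed_segment 0 x" if "t \<in> {0..u}" for t
    using that u by (intro of_real_mult_in_closed_segment) auto
  have "continuous_on {0..u} (\<lambda>t. Q (of_real t * x))"
    by (rule continuous_on_compose2[of "closed_segment 0 x" Q])
       (use Q seg in \<open>auto simp: segment_primitive_def intro!: continuous_intros\<close>)
  moreover have "((\<lambda>t. Q (of_real t * x)) has_vector_derivative pullback x q t) (at t)"
    if "t \<in> {0<..<u}" for t
  proof (cases "x = 0")
    case True
    then show ?thesis by (simp add: pullback_def)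
  next
    case False
    have "((\<lambda>t. of_real t * x) has_vector_derivative x) (at t)"
      by (auto intro!: derivative_eq_intros simp: has_vector_derivative_def scaleR_conv_of_real)
    moreover have "(Q has_field_derivative q (of_real t * x)) (at (of_real t * x))"
      using Q seg[of t] that False by (auto simp: segment_primitive_def)
    ultimately show ?thesis
      using field_vector_diff_chain_at[of "\<lambda>t. of_real t * x"]
      by (fastforce simp: o_def pullback_def mult.commute)
  qed
  ultimately have "(LINT t:{0<..<u}|lborel. pullback x q t) = Q (of_real u * x) - Q (of_real 0 * x)"
    using u int by (intro set_integral_Ioo_FTC) auto
  then show ?thesis
    using Q by (simp add: segment_primitive_def)
qed

lemma simplex_integral_snoc_primitive:
  assumes adm: "simplex_admissible (gs @ [g])" and Q: "segment_primitive x q Q"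
    and q: "\<And>t. t \<in> {0<..<1} \<Longrightarrow> g t * simplex_integral gs t = pullback x q t"
    and u: "u \<in> {0<..1}"
  shows "simplex_integral (gs @ [g]) u = Q (of_real u * x)"
proof -
  have eq: "g t * simplex_integral gs t = pullback x q t" if "t \<in> {0<..<u}" for t
    using that u by (intro q) auto
  have "set_integrable lborel {0<..<u} (\<lambda>t. g t * simplex_integral gs t)"
    using adm u by (rule set_integrable_simplex_integral)
  then have int: "set_integrable lborel {0<..<u} (pullback x q)"
    using eq by (subst (asm) set_integrable_cong) auto
  have "simplex_integral (gs @ [g]) u = (LINT t:{0<..<u}|lborel. g t * simplex_integral gs t)"
    using adm u by (rule simplex_integral_snoc)
  also have "\<dots> = (LINT t:{0<..<u}|lborel. pullback x q t)"
    using eq by (intro set_lebesgue_integral_cong) auto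
  also have "\<dots> = Q (of_real u * x)"
    using Q u int by (rule set_integral_pullback_FTC)
  finally show ?thesis .
qed

lemma borel_measurable_pullback:
  assumes [measurable]: "f \<in> borel_measurable borel"
  shows "pullback x f \<in> borel_measurable borel"
  unfolding pullback_def[abs_def] by measurable

lemma iterated_primitive_single:
  assumes meas: "f \<in> borel_measurable borel" and "bounded (f ` closed_segment 0 x)"
    and P: "segment_primitive x f P"
  shows "iterated_primitive x [f] P"
proof -
  obtain K where K: "\<And>z. z \<in> closed_segment 0 x \<Longrightarrow> norm (f z) \<le> K"
    using assms(2) by (auto simp: bounded_iff)
  have "norm (pullback x f s) \<le> K * norm x" if "s \<in> {0<..<1}" for s
    using that unfolding pullback_def norm_mult
    by (intro mult_right_mono K of_real_mult_in_closed_segment) auto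
  with borel_measurable_pullback[OF meas] have adm: "simplex_admissible ([] @ [pullback x f])"
    unfolding append_Nil by (rule simplex_admissible.single)
  show ?thesis
    using simplex_integral_snoc_primitive[OF adm P] adm
    by (simp add: iterated_primitive_def simplex_integral_Nil)
qed

lemma iterated_primitive_snoc:
  assumes P: "iterated_primitive x fs P" and meas: "f \<in> borel_measurable borel"
    and "bounded ((\<lambda>z. z * f z) ` closed_segment 0 x)"
    and Q: "segment_primitive x (\<lambda>z. f z * P z) Q"
  shows "iterated_primitive x (fs @ [f]) Q"
proof -
  obtain K where K: "\<And>z. z \<in> closed_segment 0 x \<Longrightarrow> norm (z * f z) \<le> K"
    using assms(3) by (auto simp: bounded_iff)
  have bound: "norm (pullback x f s) \<le> K / s" if "s \<in> {0<..<1}" for s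
    using that K[of "of_real s * x"] of_real_mult_in_closed_segment[of s x]
    by (simp add: pullback_def norm_mult field_simps)
  have "simplex_admissible (map (pullback x) fs)"
    using P by (simp add: iterated_primitive_def)
  then have adm: "simplex_admissible (map (pullback x) fs @ [pullback x f])"
    using borel_measurable_pullback[OF meas] bound by (rule simplex_admissible.snoc)
  have "pullback x f t * simplex_integral (map (pullback x) fs) t = pullback x (\<lambda>z. f z * P z) t"
    if "t \<in> {0<..<1}" for t
    using P that by (simp add: iterated_primitive_def pullback_def)
  then show ?thesis
    using simplex_integral_snoc_primitive[OF adm Q] adm by (simp add: iterated_primitive_def)
qed

lemma iterated_primitive_power:
  assumes "0 < p"
  shows "iterated_primitive x [\<lambda>t. of_nat p * t ^ (p - 1)] (\<lambda>z. z ^ p)"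
proof (rule iterated_primitive_single)
  show "bounded ((\<lambda>t. of_nat p * t ^ (p - 1)) ` closed_segment 0 x)"
    by (intro compact_imp_bounded compact_continuous_image continuous_intros compact_segment)
  show "segment_primitive x (\<lambda>t. of_nat p * t ^ (p - 1)) (\<lambda>z. z ^ p)"
    using assms by (auto simp: segment_primitive_def intro!: continuous_intros derivative_eq_intros)
qed auto

section \<open>Odd power series\<close>

text \<open>The coefficient of \<open>X\<^bsup>2l-1\<^esup>\<close> is \<open>c l\<close>; the value \<open>c 0\<close> is ignored.\<close>
definition odd_fps :: "(nat \<Rightarrow> 'a::zero) \<Rightarrow> 'a fps" where
  "odd_fps c = Abs_fps (\<lambda>k. if odd k then c (Suc k div 2) else 0)"

abbreviation odd_series :: "(nat \<Rightarrow> 'a::{banach, real_normed_field}) \<Rightarrow> 'a \<Rightarrow> 'a" where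
  "odd_series c \<equiv> eval_fps (odd_fps c)"

lemma fps_nth_odd_fps: "fps_nth (odd_fps c) k = (if odd k then c (Suc k div 2) else 0)"
  by (simp add: odd_fps_def)

lemma odd_fps_cong: "(\<And>l. 0 < l \<Longrightarrow> c l = d l) \<Longrightarrow> odd_fps c = odd_fps d"
  by (auto simp: fps_eq_iff fps_nth_odd_fps elim!: oddE)

lemma fps_X_mult_deriv_odd_fps:
  fixes c :: "nat \<Rightarrow> 'a::comm_semiring_1"
  shows "fps_X * fps_deriv (odd_fps c) = odd_fps (\<lambda>l. of_nat (2 * l - 1) * c l)"
proof (rule fps_ext)
  show "fps_nth (fps_X * fps_deriv (odd_fps c)) k =
      fps_nth (odd_fps (\<lambda>l. of_nat (2 * l - 1) * c l)) k" for k
    by (cases k) (auto simp: fps_nth_odd_fps elim!: evenE)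
qed

lemma odd_fps_partial_sums:
  fixes c :: "nat \<Rightarrow> 'a::comm_ring_1"
  assumes "c 0 = 0"
  shows "(1 - fps_X ^ 2) * odd_fps (\<lambda>l. \<Sum>j<l. c j) = fps_X ^ 2 * odd_fps c"
proof (rule fps_ext)
  fix k :: nat
  consider "k = 0" | "k = 1" | i where "k = i + 2"
    by atomize_elim presburger
  then show "fps_nth ((1 - fps_X ^ 2) * odd_fps (\<lambda>l. \<Sum>j<l. c j)) k = fps_nth (fps_X ^ 2 * odd_fps c) k"
    using assms by cases (auto simp: fps_nth_odd_fps left_diff_distrib fps_X_power_mult_nth)
qed

lemma fps_conv_radius_ge_1:
  fixes F :: "'a::{banach, real_normed_field} fps"
  assumes "\<And>k. norm (fps_nth F k) \<le> B"
  shows "1 \<le> fps_conv_radius F"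
  unfolding fps_conv_radius_def
proof (rule conv_radius_geI_ex')
  fix r :: real assume "0 < r" "ereal r < 1"
  then have "summable (\<lambda>k. B * r ^ k)"
    by (intro summable_mult summable_geometric) auto
  moreover have "norm (fps_nth F k * of_real r ^ k) \<le> B * r ^ k" for k
    using assms \<open>0 < r\<close> by (simp add: norm_mult norm_power mult_right_mono)
  ultimately show "summable (\<lambda>k. fps_nth F k * of_real r ^ k)"
    by (rule summable_comparison_test')
qed

lemma norm_less_fps_conv_radius_odd_fps:
  fixes c :: "nat \<Rightarrow> 'a::{banach, real_normed_field}"
  assumes c: "\<And>l. norm (c l) \<le> B" and "norm z < 1"
  shows "norm z < fps_conv_radius (odd_fps c)"
proof -
  have coeff: "norm (fps_nth (odd_fps c) k) \<le> B" for k
    using c order_trans[OF norm_ge_zero c] by (simp add: fps_nth_odd_fps)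
  have "ereal (norm z) < 1"
    using \<open>norm z < 1\<close> by (simp add: one_ereal_def)
  also have "1 \<le> fps_conv_radius (odd_fps c)"
    using coeff by (rule fps_conv_radius_ge_1)
  finally show ?thesis .
qed

lemma sums_odd_series:
  fixes c :: "nat \<Rightarrow> 'a::{banach, real_normed_field}"
  assumes "\<And>l. norm (c l) \<le> B" and "norm z < 1"
  shows "(\<lambda>l. c (Suc l) * z ^ (2 * l + 1)) sums odd_series c z"
proof -
  have "norm z < fps_conv_radius (odd_fps c)"
    using assms by (rule norm_less_fps_conv_radius_odd_fps)
  then have "(\<lambda>k. fps_nth (odd_fps c) k * z ^ k) sums odd_series c z"
    by (rule sums_eval_fps)
  moreover have "strict_mono (\<lambda>l::nat. 2 * l + 1)"
    by (auto simp: strict_mono_def)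
  moreover have "fps_nth (odd_fps c) k * z ^ k = 0" if "k \<notin> range (\<lambda>l. 2 * l + 1)" for k
    using that by (auto simp: fps_nth_odd_fps elim: oddE)
  ultimately have "(\<lambda>l. fps_nth (odd_fps c) (2 * l + 1) * z ^ (2 * l + 1)) sums odd_series c z"
    by (subst sums_mono_reindex) auto
  then show ?thesis
    by (simp add: fps_nth_odd_fps)
qed

lemma segment_primitive_odd_series:
  assumes "\<And>l. norm (c l) \<le> B" and x: "norm x < 1"
    and q: "\<And>z. norm z < 1 \<Longrightarrow> z \<noteq> 0 \<Longrightarrow>
      z * q z = odd_series (\<lambda>l. of_nat (2 * l - 1) * c l) z"
  shows "segment_primitive x q (odd_series c)"
proof -
  have radius: "norm z < fps_conv_radius (odd_fps c)" if "norm z < 1" for z :: complex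
    using assms(1) that by (rule norm_less_fps_conv_radius_odd_fps)
  have seg: "norm z < 1" if "z \<in> closed_segment 0 x" for z
    using segment_bound1[OF that] x by simp
  have "continuous_on (closed_segment 0 x) (odd_series c)"
    using radius seg by (intro continuous_on_subset[OF continuous_on_eval_fps]) auto
  moreover have "odd_series c 0 = 0"
    by (simp add: eval_fps_at_0 fps_nth_odd_fps)
  moreover have "(odd_series c has_field_derivative q z) (at z)"
    if "norm z < 1" "z \<noteq> 0" for z
  proof -
    have "norm z < fps_conv_radius (fps_deriv (odd_fps c))"
      using radius[OF that(1)] fps_conv_radius_deriv by (rule less_le_trans)
    then have "z * q z = z * eval_fps (fps_deriv (odd_fps c)) z"
      using q[OF that] unfolding fps_X_mult_deriv_odd_fps[symmetric] by (simp add: eval_fps_mult)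
    then show ?thesis
      using has_field_derivative_eval_fps[OF radius[OF that(1)]] that(2) by simp
  qed
  ultimately show ?thesis
    using seg by (auto simp: segment_primitive_def)
qed

text \<open>The forms \<open>blk m (\<lambda>t. t / (1 - t\<^sup>2))\<close> act on the coefficients of an odd power series by
  \<open>blk_coeff m\<close>.\<close>
definition blk_coeff :: "nat \<Rightarrow> (nat \<Rightarrow> 'a::field) \<Rightarrow> nat \<Rightarrow> 'a" where
  "blk_coeff m c l = (\<Sum>j<l. c j) / of_nat (2 * l - 1) ^ m"

lemma blk_coeff_at_0: "blk_coeff m c 0 = 0"
  by (simp add: blk_coeff_def)

lemma of_nat_mult_blk_coeff_Suc:
  fixes c :: "nat \<Rightarrow> 'a::field_char_0"
  assumes "0 < l"
  shows "of_nat (2 * l - 1) * blk_coeff (Suc m) c l = blk_coeff m c l"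
proof -
  have "of_nat (2 * l - 1) \<noteq> (0::'a)"
    using assms by (subst of_nat_eq_0_iff) simp
  then show ?thesis
    by (simp add: blk_coeff_def del: of_nat_diff_if of_nat_diff)
qed

lemma odd_fps_blk_coeff_1:
  fixes c :: "nat \<Rightarrow> 'a::field_char_0"
  shows "odd_fps (\<lambda>l. of_nat (2 * l - 1) * blk_coeff 1 c l) = odd_fps (\<lambda>l. \<Sum>j<l. c j)"
  by (rule odd_fps_cong) (use of_nat_mult_blk_coeff_Suc[of _ 0 c] in \<open>simp add: blk_coeff_def[of 0]\<close>)

lemma norm_blk_coeff_le:
  fixes c :: "nat \<Rightarrow> 'a::real_normed_field"
  assumes c: "\<And>l. norm (c l) \<le> B" and "1 \<le> m"
  shows "norm (blk_coeff m c l) \<le> B"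
proof (cases "l = 0")
  case True
  then show ?thesis
    using order_trans[OF norm_ge_zero c] by (simp add: blk_coeff_at_0)
next
  case False
  have "norm (\<Sum>j<l. c j) \<le> real l * B"
    using sum_norm_bound[of "{..<l}" c B] c by simp
  also have "\<dots> \<le> real ((2 * l - 1) ^ m) * B"
  proof (intro mult_right_mono of_nat_mono)
    have "l \<le> (2 * l - 1) ^ 1" by simp
    also have "\<dots> \<le> (2 * l - 1) ^ m" using False \<open>1 \<le> m\<close> by (intro power_increasing) auto
    finally show "l \<le> (2 * l - 1) ^ m" .
  qed (rule order_trans[OF norm_ge_zero c])
  finally have "norm (\<Sum>j<l. c j) / real ((2 * l - 1) ^ m) \<le> B"
    using False by (subst pos_divide_le_eq) (simp_all add: mult.commute)
  then show ?thesis
    by (simp only: blk_coeff_def norm_divide norm_power norm_of_nat of_nat_power)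
qed

lemma odd_series_partial_sums:
  fixes c :: "nat \<Rightarrow> 'a::{banach, real_normed_field}"
  assumes c: "\<And>l. norm (c l) \<le> B" "c 0 = 0" and z: "norm z < 1"
  shows "odd_series (\<lambda>l. \<Sum>j<l. c j) z = z\<^sup>2 / (1 - z\<^sup>2) * odd_series c z"
proof -
  let ?S = "odd_fps (\<lambda>l. \<Sum>j<l. c j)"
  have S: "?S = fps_X * fps_deriv (odd_fps (blk_coeff 1 c))"
    unfolding fps_X_mult_deriv_odd_fps odd_fps_blk_coeff_1 ..
  have "norm (blk_coeff 1 c l) \<le> B" for l
    using c(1) by (rule norm_blk_coeff_le) simp
  then have "norm z < fps_conv_radius (odd_fps (blk_coeff 1 c))"
    using z by (rule norm_less_fps_conv_radius_odd_fps)
  also have "\<dots> \<le> fps_conv_radius (fps_deriv (odd_fps (blk_coeff 1 c)))"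
    by (rule fps_conv_radius_deriv)
  also have "\<dots> \<le> fps_conv_radius ?S"
    unfolding S using fps_conv_radius_mult[of fps_X] by simp
  finally have "norm z < fps_conv_radius ?S" .
  moreover have "fps_conv_radius (1 - fps_X ^ 2 :: 'a fps) = \<infinity>"
    using fps_conv_radius_diff[of 1 "fps_X ^ 2 :: 'a fps"] by simp
  ultimately have "(1 - z\<^sup>2) * eval_fps ?S z = eval_fps ((1 - fps_X ^ 2) * ?S) z"
    by (simp add: eval_fps_mult eval_fps_diff)
  also have "\<dots> = z\<^sup>2 * odd_series c z"
    unfolding odd_fps_partial_sums[of c, OF c(2)]
    using norm_less_fps_conv_radius_odd_fps[of c, OF c(1) z] by (simp add: eval_fps_mult)
  finally have "(1 - z\<^sup>2) * eval_fps ?S z = z\<^sup>2 * odd_series c z" .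
  moreover have "1 - z\<^sup>2 \<noteq> 0"
    using z by (auto simp: power2_eq_1_iff)
  ultimately show ?thesis
    by (simp add: eq_divide_eq mult.commute)
qed

lemma iterated_primitive_replicate:
  assumes c: "\<And>l. norm (c l) \<le> B" and x: "norm x < 1"
    and P: "iterated_primitive x fs (odd_series (blk_coeff 1 c))"
  shows "iterated_primitive x (fs @ replicate p (\<lambda>t. 1 / t)) (odd_series (blk_coeff (Suc p) c))"
proof (induction p)
  case 0
  then show ?case using P by simp
next
  case (Suc p)
  have "segment_primitive x (\<lambda>z. 1 / z * odd_series (blk_coeff (Suc p) c) z)
      (odd_series (blk_coeff (Suc (Suc p)) c))"
  proof (rule segment_primitive_odd_series[OF norm_blk_coeff_le[OF c] x])
    have "odd_fps (\<lambda>l. of_nat (2 * l - 1) * blk_coeff (Suc (Suc p)) c l) = odd_fps (blk_coeff (Suc p) c)"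
      by (rule odd_fps_cong) (rule of_nat_mult_blk_coeff_Suc)
    then show "z * (1 / z * odd_series (blk_coeff (Suc p) c) z) =
        odd_series (\<lambda>l. of_nat (2 * l - 1) * blk_coeff (Suc (Suc p)) c l) z" if "z \<noteq> 0" for z
      using that by simp
  qed simp
  moreover have "bounded ((\<lambda>z. z * (1 / z)) ` closed_segment 0 x)"
    by (rule bounded_subset[of "{0, 1}"]) auto
  ultimately have "iterated_primitive x ((fs @ replicate p (\<lambda>t. 1 / t)) @ [\<lambda>t. 1 / t])
      (odd_series (blk_coeff (Suc (Suc p)) c))"
    using Suc by (intro iterated_primitive_snoc) auto
  then show ?case by (simp add: replicate_append_same)
qed

lemma iterated_primitive_blk:
  assumes c: "\<And>l. norm (c l) \<le> B" "c 0 = 0" and m: "1 \<le> m" and x: "norm x < 1"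
    and P: "iterated_primitive x fs P" and meas: "f \<in> borel_measurable borel"
    and bounded: "bounded ((\<lambda>z. z * f z) ` closed_segment 0 x)"
    and f: "\<And>z. norm z < 1 \<Longrightarrow> z \<noteq> 0 \<Longrightarrow> f z * P z = z / (1 - z\<^sup>2) * odd_series c z"
  shows "iterated_primitive x (fs @ blk m f) (odd_series (blk_coeff m c))"
proof -
  have "segment_primitive x (\<lambda>z. f z * P z) (odd_series (blk_coeff 1 c))"
  proof (rule segment_primitive_odd_series[OF norm_blk_coeff_le[OF c(1)] x])
    fix z :: complex assume z: "norm z < 1" "z \<noteq> 0"
    have "z * (f z * P z) = odd_series (\<lambda>l. \<Sum>j<l. c j) z"
      using f[OF z] odd_series_partial_sums[of c, OF c z(1)] by (simp add: power2_eq_square)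
    then show "z * (f z * P z) = odd_series (\<lambda>l. of_nat (2 * l - 1) * blk_coeff 1 c l) z"
      unfolding odd_fps_blk_coeff_1 .
  qed simp
  with P meas bounded have "iterated_primitive x (fs @ [f]) (odd_series (blk_coeff 1 c))"
    by (rule iterated_primitive_snoc)
  with c(1) x have "iterated_primitive x ((fs @ [f]) @ replicate (m - 1) (\<lambda>t. 1 / t))
      (odd_series (blk_coeff (Suc (m - 1)) c))"
    by (rule iterated_primitive_replicate)
  then show ?thesis using m by (simp add: blk_def)
qed

section \<open>Tails of multiple t-polylogarithms\<close>

definition ti_coeff :: "nat \<Rightarrow> nat list \<Rightarrow> nat \<Rightarrow> 'a::field" where
  "ti_coeff n ks = foldr blk_coeff ks (\<lambda>l. if l = n then 1 else 0)"

lemma ti_coeff_simps: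
  "ti_coeff n [] = (\<lambda>l. if l = n then 1 else 0)"
  "ti_coeff n (k # ks) = blk_coeff k (ti_coeff n ks)"
  by (simp_all add: ti_coeff_def)

lemma norm_ti_coeff_le:
  assumes "\<forall>k\<in>set ks. 1 \<le> k"
  shows "norm (ti_coeff n ks l :: 'a::real_normed_field) \<le> 1"
  using assms by (induction ks arbitrary: l) (auto simp: ti_coeff_simps intro!: norm_blk_coeff_le)

text \<open>The sum of \<open>x\<^bsup>2n\<^sub>1-1\<^esup> / \<Prod>\<^sub>i (2n\<^sub>i-1)\<^bsup>k\<^sub>i\<^esup>\<close> over \<open>n\<^sub>1 > \<dots> > n\<^sub>r > n\<close>.\<close>
definition ti_tail :: "nat \<Rightarrow> nat list \<Rightarrow> complex \<Rightarrow> complex" where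
  "ti_tail n ks = odd_series (ti_coeff n ks)"

lemma ti_tail_sums:
  assumes "\<forall>k\<in>set ks. 1 \<le> k" "norm x < 1"
  shows "(\<lambda>l. ti_coeff n ks (Suc l) * x ^ (2 * l + 1)) sums ti_tail n ks x"
  unfolding ti_tail_def by (rule sums_odd_series[OF norm_ti_coeff_le[OF assms(1)] assms(2)])

lemma ti_tail_Nil:
  assumes "0 < n"
  shows "ti_tail n [] z = z ^ (2 * n - 1)"
proof -
  have "odd_fps (ti_coeff n []) = (fps_X ^ (2 * n - 1) :: complex fps)"
    using assms by (auto simp: fps_eq_iff fps_nth_odd_fps ti_coeff_simps elim!: oddE)
  then show ?thesis by (simp add: ti_tail_def)
qed

abbreviation (input) odd_blks :: "nat list \<Rightarrow> (complex \<Rightarrow> complex) list" where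
  "odd_blks ms \<equiv> concat (map (\<lambda>k. blk k (\<lambda>t. t / (1 - t\<^sup>2))) ms)"

lemma bounded_image_closed_segment:
  fixes x :: complex
  assumes "norm x < 1" "continuous_on (ball 0 1) h"
  shows "bounded (h ` closed_segment 0 x)"
proof -
  have "closed_segment 0 x \<subseteq> ball 0 1"
    using assms(1) by (intro closed_segment_subset) auto
  then show ?thesis
    using assms(2) compact_segment
    by (intro compact_imp_bounded compact_continuous_image) (auto intro: continuous_on_subset)
qed

lemma iterated_primitive_odd_blks:
  assumes ms: "\<forall>m\<in>set ms. 1 \<le> m" and ks: "\<forall>k\<in>set ks. 1 \<le> k" and n: "0 < n" and x: "norm x < 1"
    and P: "iterated_primitive x fs (ti_tail n ks)"
  shows "iterated_primitive x (fs @ odd_blks ms) (ti_tail n (rev ms @ ks))"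
  using ms
proof (induction ms rule: rev_induct)
  case Nil
  then show ?case using P by simp
next
  case (snoc m ms)
  have "\<forall>k\<in>set (rev ms @ ks). 1 \<le> k"
    using snoc.prems ks by auto
  then have "norm (ti_coeff n (rev ms @ ks) l :: complex) \<le> 1" for l
    by (rule norm_ti_coeff_le)
  then have "iterated_primitive x ((fs @ odd_blks ms) @ blk m (\<lambda>t. t / (1 - t\<^sup>2)))
      (odd_series (blk_coeff m (ti_coeff n (rev ms @ ks))))"
  proof (rule iterated_primitive_blk)
    show "ti_coeff n (rev ms @ ks) 0 = (0 :: complex)"
      using n by (cases "rev ms @ ks") (auto simp: ti_coeff_simps blk_coeff_at_0)
    show "bounded ((\<lambda>z. z * (z / (1 - z\<^sup>2))) ` closed_segment 0 x)"
      using x by (intro bounded_image_closed_segment continuous_intros) (auto simp: power2_eq_1_iff)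
  qed (use snoc x in \<open>auto simp: ti_tail_def\<close>)
  then show ?case by (simp add: ti_tail_def ti_coeff_simps)
qed

lemma iint_even_power_eq_ti_tail:
  assumes x: "norm x < 1" and ms: "\<forall>m\<in>set ms. 1 \<le> m" and n: "0 < n"
  shows "of_nat (2 * n - 1) * iint 0 x ((\<lambda>t. t ^ (2 * n - 2)) # odd_blks ms) = ti_tail n (rev ms) x"
proof -
  have "iterated_primitive x [\<lambda>t. of_nat (2 * n - 1) * t ^ (2 * n - 2)] (ti_tail n [])"
    using iterated_primitive_power[of "2 * n - 1" x] n
    by (simp add: ti_tail_Nil[OF n, abs_def] numeral_2_eq_2)
  then have "iterated_primitive x ([\<lambda>t. of_nat (2 * n - 1) * t ^ (2 * n - 2)] @ odd_blks ms)
      (ti_tail n (rev ms @ []))"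
    using ms n x by (intro iterated_primitive_odd_blks) auto
  from iterated_primitive_iint[OF this] show ?thesis
    by (simp add: iint_Cons_cmult)
qed

lemma iint_odd_power_eq_ti_tail:
  assumes x: "norm x < 1" and ms: "\<forall>m\<in>set (m # ms). 1 \<le> m" and n: "0 < n"
  shows "of_nat (2 * n) * iint 0 x ((\<lambda>t. t ^ (2 * n - 1)) # blk m (\<lambda>t. 1 / (1 - t\<^sup>2)) @ odd_blks ms) =
    ti_tail n (rev (m # ms)) x"
proof -
  have "iterated_primitive x ([\<lambda>t. of_nat (2 * n) * t ^ (2 * n - 1)] @ blk m (\<lambda>t. 1 / (1 - t\<^sup>2)))
      (odd_series (blk_coeff m (ti_coeff n [])))"
  proof (rule iterated_primitive_blk)
    show "iterated_primitive x [\<lambda>t. of_nat (2 * n) * t ^ (2 * n - 1)] (\<lambda>z. z ^ (2 * n))"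
      using n by (intro iterated_primitive_power) simp
    show "bounded ((\<lambda>z. z * (1 / (1 - z\<^sup>2))) ` closed_segment 0 x)"
      using x by (intro bounded_image_closed_segment continuous_intros) (auto simp: power2_eq_1_iff)
    show "1 / (1 - z\<^sup>2) * z ^ (2 * n) = z / (1 - z\<^sup>2) * odd_series (ti_coeff n []) z" for z :: complex
      using ti_tail_Nil[OF n, of z] n by (simp add: ti_tail_def flip: power_Suc)
  qed (use x ms n in \<open>auto simp: ti_coeff_simps norm_ti_coeff_le\<close>)
  then have "iterated_primitive x (([\<lambda>t. of_nat (2 * n) * t ^ (2 * n - 1)] @ blk m (\<lambda>t. 1 / (1 - t\<^sup>2))) @
      odd_blks ms) (ti_tail n (rev ms @ [m]))"
    using ms n x by (intro iterated_primitive_odd_blks) (auto simp: ti_tail_def ti_coeff_simps)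
  from iterated_primitive_iint[OF this] show ?thesis
    by (simp add: iint_Cons_cmult)
qed

lemma ti_coeff_0_snoc:
  "ti_coeff 0 (ks @ [m]) l =
    ti_coeff n (ks @ [m]) l + (\<Sum>i=1..n. ti_coeff i ks l / of_nat (2 * i - 1) ^ m)"
proof (induction ks arbitrary: l)
  case Nil
  have "(\<Sum>i=1..n. ti_coeff i [] l / of_nat (2 * i - 1) ^ m :: 'a) =
      (\<Sum>i=1..n. if i = l then 1 / of_nat (2 * i - 1) ^ m else 0)"
    by (intro sum.cong) (auto simp: ti_coeff_simps)
  then show ?case
    by (auto simp: ti_coeff_simps blk_coeff_def sum.delta)
next
  case (Cons k ks)
  have "(\<Sum>j<l. ti_coeff 0 (ks @ [m]) j) = (\<Sum>j<l. ti_coeff n (ks @ [m]) j) +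
      (\<Sum>i=1..n. (\<Sum>j<l. ti_coeff i ks j) / of_nat (2 * i - 1) ^ m :: 'a)"
    unfolding Cons.IH sum.distrib sum_divide_distrib by (subst sum.swap) (rule refl)
  then show ?case
    by (simp add: ti_coeff_simps blk_coeff_def add_divide_distrib sum_divide_distrib
        divide_divide_eq_left mult.commute)
qed

lemma ti_tail_0_snoc:
  assumes ks: "\<forall>k\<in>set (ks @ [m]). 1 \<le> k" and x: "norm x < 1"
  shows "ti_tail 0 (ks @ [m]) x =
    ti_tail n (ks @ [m]) x + (\<Sum>i=1..n. ti_tail i ks x / of_nat (2 * i - 1) ^ m)"
proof -
  have tails: "(\<lambda>l. ti_coeff i ks (Suc l) * x ^ (2 * l + 1)) sums ti_tail i ks x" for i
    using ks x by (intro ti_tail_sums) auto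
  have "(\<lambda>l. ti_coeff n (ks @ [m]) (Suc l) * x ^ (2 * l + 1) +
      (\<Sum>i=1..n. ti_coeff i ks (Suc l) * x ^ (2 * l + 1) / of_nat (2 * i - 1) ^ m)) sums
      (ti_tail n (ks @ [m]) x + (\<Sum>i=1..n. ti_tail i ks x / of_nat (2 * i - 1) ^ m))"
    by (intro sums_add sums_sum sums_divide tails ti_tail_sums[OF ks x])
  also have "(\<lambda>l. ti_coeff n (ks @ [m]) (Suc l) * x ^ (2 * l + 1) +
      (\<Sum>i=1..n. ti_coeff i ks (Suc l) * x ^ (2 * l + 1) / of_nat (2 * i - 1) ^ m)) =
      (\<lambda>l. ti_coeff 0 (ks @ [m]) (Suc l) * x ^ (2 * l + 1))"
    unfolding ti_coeff_0_snoc[where n=n]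
    by (simp only: distrib_right sum_distrib_right times_divide_eq_left)
  finally show ?thesis
    using ti_tail_sums[OF ks x] by (rule sums_unique2[symmetric])
qed

definition ti_term :: "nat list \<Rightarrow> 'a::field \<Rightarrow> nat list \<Rightarrow> 'a" where
  "ti_term ks x ns = x ^ (2 * hd ns - 1) * (\<Prod>i<length ks. 1 / of_nat (2 * ns ! i - 1) ^ (ks ! i))"

definition idx_gt_below :: "nat \<Rightarrow> nat \<Rightarrow> nat list set" where
  "idx_gt_below r l = {ns \<in> idx_gt r. \<forall>n\<in>set ns. n < l}"

lemma idx_gt_conv_set: "idx_gt r = {ns. length ns = r \<and> (\<forall>n\<in>set ns. 0 < n) \<and> sorted_wrt (>) ns}"
  by (auto simp: idx_gt_def all_set_conv_all_nth)

lemma finite_idx_gt_below: "finite (idx_gt_below r l)"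
  by (rule finite_subset[OF _ finite_lists_length_eq[of "{..<l}" r]])
     (auto simp: idx_gt_below_def idx_gt_conv_set)

lemma idx_gt_below_0: "idx_gt_below 0 l = {[]}"
  by (auto simp: idx_gt_below_def idx_gt_conv_set)

lemma idx_gt_Suc: "idx_gt (Suc r) = (\<lambda>(j, ns). j # ns) ` (SIGMA j:{0<..}. idx_gt_below r j)"
  by (force simp: idx_gt_below_def idx_gt_conv_set length_Suc_conv)

lemma idx_gt_below_Suc:
  "idx_gt_below (Suc r) l = (\<lambda>(j, ns). j # ns) ` (SIGMA j:{0<..<l}. idx_gt_below r j)"
  unfolding idx_gt_below_def[of "Suc r"] idx_gt_Suc by (force simp: idx_gt_below_def)

lemma inj_on_case_prod_Cons: "inj_on (\<lambda>(j, ns). j # ns) A"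
  by (auto simp: inj_on_def)

lemma sum_idx_gt_below_eq_sum_ti_coeff:
  assumes "0 < l"
  shows "(\<Sum>ns\<in>idx_gt_below (length ks) l. \<Prod>i<length ks. 1 / of_nat (2 * ns ! i - 1) ^ (ks ! i)) =
    (\<Sum>j<l. ti_coeff 0 ks j :: 'a::field)"
  using assms
proof (induction ks arbitrary: l)
  case Nil
  then show ?case by (simp add: idx_gt_below_0 ti_coeff_simps sum.delta)
next
  case (Cons k ks)
  let ?w = "\<lambda>ns. \<Prod>i<length ks. 1 / of_nat (2 * ns ! i - 1) ^ (ks ! i) :: 'a"
  have "(\<Sum>ns\<in>idx_gt_below (Suc (length ks)) l.
        \<Prod>i<Suc (length ks). 1 / of_nat (2 * ns ! i - 1) ^ ((k # ks) ! i) :: 'a) =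
      (\<Sum>j\<in>{0<..<l}. \<Sum>ns\<in>idx_gt_below (length ks) j. 1 / of_nat (2 * j - 1) ^ k * ?w ns)"
    unfolding idx_gt_below_Suc sum.reindex[OF inj_on_case_prod_Cons]
    by (simp add: case_prod_unfold sum.Sigma finite_idx_gt_below prod.lessThan_Suc_shift
        del: prod.lessThan_Suc of_nat_diff)
  also have "\<dots> = (\<Sum>j\<in>{0<..<l}. ti_coeff 0 (k # ks) j)"
  proof (intro sum.cong refl)
    fix j assume "j \<in> {0<..<l}"
    then show "(\<Sum>ns\<in>idx_gt_below (length ks) j. 1 / of_nat (2 * j - 1) ^ k * ?w ns) =
        ti_coeff 0 (k # ks) j"
      unfolding sum_distrib_left[symmetric]
      using Cons.IH[of j] by (simp add: ti_coeff_simps blk_coeff_def)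
  qed
  also have "\<dots> = (\<Sum>j<l. ti_coeff 0 (k # ks) j)"
    by (rule sum.mono_neutral_left) (auto simp: ti_coeff_simps blk_coeff_at_0)
  finally show ?case by simp
qed

lemma sum_ti_term_Cons:
  assumes "0 < l"
  shows "(\<Sum>ns\<in>idx_gt_below (length ks) l. ti_term (k # ks) x (l # ns)) =
    ti_coeff 0 (k # ks) l * x ^ (2 * l - 1)"
proof -
  have Cons: "ti_term (k # ks) x (l # ns) = x ^ (2 * l - 1) / of_nat (2 * l - 1) ^ k *
      (\<Prod>i<length ks. 1 / of_nat (2 * ns ! i - 1) ^ (ks ! i))" for ns
    by (simp add: ti_term_def prod.lessThan_Suc_shift del: prod.lessThan_Suc)
  show ?thesis
    unfolding Cons sum_distrib_left[symmetric] sum_idx_gt_below_eq_sum_ti_coeff[OF assms]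
    by (simp add: ti_coeff_simps blk_coeff_def)
qed

lemma norm_ti_term:
  fixes x :: "'a::real_normed_field"
  shows "norm (ti_term ks x ns) = ti_term ks (norm x) ns"
  unfolding ti_term_def norm_mult norm_power prod_norm[symmetric] norm_divide norm_one norm_of_nat ..

lemma abs_summable_ti_coeff:
  fixes x :: "'a::real_normed_field"
  assumes ks: "\<forall>k\<in>set ks. 1 \<le> k" and x: "norm x < 1"
  shows "(\<lambda>l. norm (ti_coeff n ks l * x ^ (2 * l - 1))) summable_on {0<..}"
proof (rule Infinite_Sum.abs_summable_on_comparison_test)
  have "(\<lambda>l. norm (x ^ l)) summable_on UNIV"
    using x by (intro norm_summable_imp_summable_on) (simp add: norm_power summable_geometric)
  then show "(\<lambda>l. norm (x ^ l)) summable_on {0<..}"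
    by (rule summable_on_subset_banach) simp
  fix l :: nat assume "l \<in> {0<..}"
  then have "norm (x ^ (2 * l - 1)) \<le> norm (x ^ l)"
    unfolding norm_power using x by (intro power_decreasing) auto
  then have "norm (ti_coeff n ks l :: 'a) * norm (x ^ (2 * l - 1)) \<le> 1 * norm (x ^ l)"
    by (intro mult_mono norm_ti_coeff_le ks) auto
  then show "norm (ti_coeff n ks l * x ^ (2 * l - 1)) \<le> norm (x ^ l)"
    by (simp add: norm_mult)
qed

lemma abs_summable_ti_term:
  fixes x :: "'a::real_normed_field"
  assumes ks: "\<forall>k\<in>set (k # ks). 1 \<le> k" and x: "norm x < 1"
  shows "(\<lambda>(l, ns). norm (ti_term (k # ks) x (l # ns))) summable_on
    (SIGMA l:{0<..}. idx_gt_below (length ks) l)"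
proof -
  let ?A = "idx_gt_below (length ks)"
  let ?t = "\<lambda>(l, ns). ti_term (k # ks) x (l # ns)"
  have "(\<Sum>\<^sub>\<infinity>ns\<in>?A l. norm (?t (l, ns))) = ti_coeff 0 (k # ks) l * norm x ^ (2 * l - 1)"
    if "l \<in> {0<..}" for l
    using that
    by (simp only: prod.case infsum_finite[OF finite_idx_gt_below] norm_ti_term sum_ti_term_Cons
        greaterThan_iff)
  moreover have "(\<lambda>l. norm (ti_coeff 0 (k # ks) l * norm x ^ (2 * l - 1))) summable_on {0<..}"
    using ks x by (intro abs_summable_ti_coeff) auto
  ultimately have "(\<lambda>l. norm (\<Sum>\<^sub>\<infinity>ns\<in>?A l. norm (?t (l, ns)))) summable_on {0<..}"
    by (simp only: cong: summable_on_cong)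
  then have "(\<lambda>p. norm (?t p)) summable_on (SIGMA l:{0<..}. ?A l)"
    unfolding Infinite_Sum.abs_summable_on_Sigma_iff by (simp add: finite_idx_gt_below)
  then show ?thesis by (simp add: case_prod_unfold)
qed

lemma has_sum_ti_tail:
  assumes ks: "\<forall>k\<in>set ks. 1 \<le> k" and x: "norm x < 1"
  shows "((\<lambda>l. ti_coeff n ks l * x ^ (2 * l - 1)) has_sum ti_tail n ks x) {0<..}"
proof -
  have "(\<lambda>l. ti_coeff n ks l * x ^ (2 * l - 1)) summable_on {0<..}"
    using ks x by (rule abs_summable_summable[OF abs_summable_ti_coeff])
  then obtain S where S: "((\<lambda>l. ti_coeff n ks l * x ^ (2 * l - 1)) has_sum S) {0<..}"
    by (auto simp: summable_on_def)
  then have "((\<lambda>l. ti_coeff n ks (Suc l) * x ^ (2 * l + 1)) has_sum S) UNIV"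
    unfolding greaterThan_0 by (subst (asm) has_sum_reindex) (simp_all add: o_def)
  then have "(\<lambda>l. ti_coeff n ks (Suc l) * x ^ (2 * l + 1)) sums S"
    by (rule has_sum_imp_sums)
  with S show ?thesis
    using sums_unique2[OF ti_tail_sums[OF ks x]] by simp
qed

lemma ti_eq_ti_tail:
  assumes "ks \<noteq> []" and ks: "\<forall>k\<in>set ks. 1 \<le> k" and x: "norm x < 1"
  shows "ti ks x = ti_tail 0 ks x"
proof -
  obtain k ks' where Cons: "ks = k # ks'"
    using \<open>ks \<noteq> []\<close> by (cases ks) auto
  let ?A = "idx_gt_below (length ks')"
  have summable: "(\<lambda>(l, ns). ti_term ks x (l # ns)) summable_on (SIGMA l:{0<..}. ?A l)"
    by (rule abs_summable_summable)
       (use abs_summable_ti_term[of k ks' x] ks x in \<open>simp add: Cons case_prod_unfold\<close>)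
  have "ti ks x = (\<Sum>\<^sub>\<infinity>(l, ns)\<in>(SIGMA l:{0<..}. ?A l). ti_term ks x (l # ns))"
    unfolding ti_def Cons length_Cons idx_gt_Suc infsum_reindex[OF inj_on_case_prod_Cons]
    by (simp add: o_def case_prod_unfold ti_term_def del: prod.lessThan_Suc)
  also have "\<dots> = (\<Sum>\<^sub>\<infinity>l\<in>{0<..}. \<Sum>\<^sub>\<infinity>ns\<in>?A l. ti_term ks x (l # ns))"
    using summable by (rule infsum_Sigma'_banach[symmetric])
  also have "\<dots> = (\<Sum>\<^sub>\<infinity>l\<in>{0<..}. ti_coeff 0 ks l * x ^ (2 * l - 1))"
    unfolding Cons
    by (intro infsum_cong)
       (simp only: infsum_finite[OF finite_idx_gt_below] sum_ti_term_Cons greaterThan_iff)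
  also have "\<dots> = ti_tail 0 ks x"
    using has_sum_ti_tail[OF ks x] by (rule infsumI)
  finally show ?thesis .
qed

section \<open>Multiple t-harmonic star sums\<close>

lemma idx_le_conv_set:
  "idx_le n r = {ns. length ns = r \<and> (\<forall>k\<in>set ns. 1 \<le> k \<and> k \<le> n) \<and> sorted_wrt (\<ge>) ns}"
  by (auto simp: idx_le_def all_set_conv_all_nth)

lemma finite_idx_le: "finite (idx_le n r)"
  by (rule finite_subset[OF _ finite_lists_length_eq[of "{1..n}" r]]) (auto simp: idx_le_conv_set)

lemma idx_le_0: "idx_le n 0 = {[]}"
  by (auto simp: idx_le_def)

lemma sum_idx_le_Suc:
  "(\<Sum>ns\<in>idx_le n (Suc r). F ns) = (\<Sum>l=1..n. \<Sum>ns\<in>idx_le l r. F (l # ns))"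
proof -
  have Cons: "idx_le n (Suc r) = (\<lambda>(l, ns). l # ns) ` (SIGMA l:{1..n}. idx_le l r)"
    unfolding idx_le_conv_set by (force simp: length_Suc_conv image_iff)
  show ?thesis
    unfolding Cons sum.reindex[OF inj_on_case_prod_Cons]
    by (simp add: case_prod_unfold sum.Sigma finite_idx_le)
qed

lemma tstar_Nil: "tstar n [] = 1"
  by (simp add: tstar_def idx_le_0)

lemma tstar_Cons: "tstar n (m # ms) = (\<Sum>l=1..n. tstar l ms / of_nat (2 * l - 1) ^ m)"
  by (simp add: tstar_def sum_idx_le_Suc prod.lessThan_Suc_shift sum_divide_distrib
      del: prod.lessThan_Suc)

lemma tstarx_single: "tstarx n [m] x = (\<Sum>l=1..n. x ^ (2 * l - 1) / of_nat (2 * l - 1) ^ m)"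
  by (simp add: tstarx_def sum_idx_le_Suc idx_le_0)

lemma tstarx_Cons:
  assumes "ms \<noteq> []"
  shows "tstarx n (m # ms) x = (\<Sum>l=1..n. tstarx l ms x / of_nat (2 * l - 1) ^ m)"
proof -
  have "last (l # ns) = last ns" if "ns \<in> idx_le l (length ms)" for l ns
    using that assms by (auto simp: idx_le_def)
  then show ?thesis
    by (simp add: tstarx_def sum_idx_le_Suc prod.lessThan_Suc_shift sum_divide_distrib
        del: prod.lessThan_Suc last.simps)
qed

lemma ti_tail_rev_eq_sum:
  assumes "ms \<noteq> []" "\<forall>m\<in>set ms. 1 \<le> m" and x: "norm x < 1"
  shows "ti_tail n (rev ms) x =
    (\<Sum>j<length ms. (-1) ^ j * tstar n (take j ms) * ti (rev (drop j ms)) x)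
    + (-1) ^ length ms * tstarx n ms x"
  using assms(1,2)
proof (induction ms arbitrary: n rule: list_nonempty_induct)
  case (single m)
  have "(\<Sum>l=1..n. ti_tail l [] x / of_nat (2 * l - 1) ^ m) = tstarx n [m] x"
    unfolding tstarx_single by (intro sum.cong) (auto simp: ti_tail_Nil)
  then show ?case
    using ti_tail_0_snoc[of "[]" m x n] ti_eq_ti_tail[of "[m]" x] single.prems x
    by (simp add: tstar_Nil)
next
  case (cons m ms)
  define T where "T j = ti (rev (drop j ms)) x" for j
  have "(\<Sum>l=1..n. ti_tail l (rev ms) x / of_nat (2 * l - 1) ^ m) =
      (\<Sum>l=1..n. ((\<Sum>j<length ms. (-1) ^ j * tstar l (take j ms) * T j)
         + (-1) ^ length ms * tstarx l ms x) / of_nat (2 * l - 1) ^ m)"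
    using cons by (simp add: T_def)
  also have "\<dots> = (\<Sum>j<length ms. (-1) ^ j * tstar n (m # take j ms) * T j)
         + (-1) ^ length ms * tstarx n (m # ms) x"
    unfolding tstar_Cons tstarx_Cons[OF cons.hyps(1)] add_divide_distrib sum.distrib
      sum_divide_distrib sum_distrib_left sum_distrib_right
    by (subst sum.swap) (simp add: mult_ac)
  finally have "(\<Sum>l=1..n. ti_tail l (rev ms) x / of_nat (2 * l - 1) ^ m) =
    (\<Sum>j<length ms. (-1) ^ j * tstar n (m # take j ms) * T j) + (-1) ^ length ms * tstarx n (m # ms) x" .
  moreover have "ti (rev (m # ms)) x = ti_tail 0 (rev (m # ms)) x"
    using cons.prems x by (intro ti_eq_ti_tail) auto
  moreover have "ti_tail 0 (rev (m # ms)) x = ti_tail n (rev (m # ms)) x +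
      (\<Sum>l=1..n. ti_tail l (rev ms) x / of_nat (2 * l - 1) ^ m)"
    using ti_tail_0_snoc[of "rev ms" m x n] cons.prems x by simp
  ultimately show ?case
    by (simp add: T_def tstar_Nil sum.lessThan_Suc_shift sum_negf algebra_simps del: sum.lessThan_Suc)
qed

theorem mainTheorem7:
  fixes ms :: "nat list" and n :: nat and x :: complex
  assumes "ms \<noteq> []" and "\<forall>m\<in>set ms. 1 \<le> m" and "1 \<le> n" and "norm x < 1"
  shows "of_nat (2 * n) * iint 0 x ((\<lambda>t. t ^ (2 * n - 1)) # blk (hd ms) (\<lambda>t. 1 / (1 - t\<^sup>2))
            @ concat (map (\<lambda>k. blk k (\<lambda>t. t / (1 - t\<^sup>2))) (tl ms)))
       = of_nat (2 * n - 1) * iint 0 x ((\<lambda>t. t ^ (2 * n - 2))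
            # concat (map (\<lambda>k. blk k (\<lambda>t. t / (1 - t\<^sup>2))) ms))
   \<and> of_nat (2 * n - 1) * iint 0 x ((\<lambda>t. t ^ (2 * n - 2))
            # concat (map (\<lambda>k. blk k (\<lambda>t. t / (1 - t\<^sup>2))) ms))
       = (\<Sum>j=1..length ms. (-1) ^ (j - 1) * tstar n (take (j - 1) ms) * ti (rev (drop (j - 1) ms)) x)
         + (-1) ^ length ms * tstarx n ms x"
proof -
  have "of_nat (2 * n) * iint 0 x ((\<lambda>t. t ^ (2 * n - 1)) # blk (hd ms) (\<lambda>t. 1 / (1 - t\<^sup>2))
      @ odd_blks (tl ms)) = ti_tail n (rev ms) x"
    using iint_odd_power_eq_ti_tail[of x "hd ms" "tl ms" n] assms by simp
  moreover have "of_nat (2 * n - 1) * iint 0 x ((\<lambda>t. t ^ (2 * n - 2)) # odd_blks ms) =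
      ti_tail n (rev ms) x"
    using assms by (intro iint_even_power_eq_ti_tail) auto
  moreover have "(\<Sum>j=1..length ms. (-1) ^ (j - 1) * tstar n (take (j - 1) ms) * ti (rev (drop (j - 1) ms)) x)
      = (\<Sum>j<length ms. (-1) ^ j * tstar n (take j ms) * ti (rev (drop j ms)) x)"
    by (rule sum.reindex_bij_witness[of _ Suc "\<lambda>j. j - 1"]) auto
  ultimately show ?thesis
    using ti_tail_rev_eq_sum[OF assms(1,2,4), of n] by simp
qed

end
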